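(* Let $\Sigma$ and $Q$ be $p\times p$ symmetric positive definite matrices and $A$ a $p\times p$ matrix. Then $A\Sigma=\Sigma A^\top$ and $QA=A^\top Q$ both hold if and only if there exists a nonsingular matrix $B$ such that $Q=B^\top B$, $\Sigma=B^{-1}D(B^\top)^{-1}$ and $A=B^{-1}A^*B$, where $D$ and $A^*$ are diagonal matrices whose diagonal elements are, respectively, the eigenvalues of $\Sigma Q$ and of $A$. *)

theory Defs
  imports "HOL-Analysis.Analysis"
begin

definition sym_mat :: "real^'n^'n \<Rightarrow> bool" where
  "sym_mat S \<longleftrightarrow> transpose S = S"

definition pos_def_mat :: "real^'n^'n \<Rightarrow> bool" where
  "pos_def_mat S \<longleftrightarrow> sym_mat S \<and> (\<forall>x. x \<noteq> 0 \<longrightarrow> x \<bullet> (S *v x) > 0)"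

definition diag_mat :: "real^'n^'n \<Rightarrow> bool" where
  "diag_mat D \<longleftrightarrow> (\<forall>i j. i \<noteq> j \<longrightarrow> D $ i $ j = 0)"

text \<open>The diagonal entries of D are the eigenvalues of M, counted with (algebraic)
  multiplicity: the characteristic polynomial of M splits as the product of (x - D_ii).\<close>
definition diag_of_eigenvalues :: "real^'n^'n \<Rightarrow> real^'n^'n \<Rightarrow> bool" where
  "diag_of_eigenvalues D M \<longleftrightarrow> diag_mat D \<and>
     (\<forall>x::real. det (x *\<^sub>R mat 1 - M) = (\<Prod>i\<in>UNIV. x - D $ i $ i))"

end

theory Submission
  imports Defs
begin

text \<open>Write Q = C^T C with C invertible (from the spectral decomposition of Q). Then the two
  identities say precisely that C \<Sigma> C^T and C A C^-1 are symmetric and commute. Commuting symmetric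
  matrices are diagonalised by one orthogonal U: a maximiser of the Rayleigh quotient on a subspace
  invariant under both is a common eigenvector, and its orthogonal complement is again invariant.
  B = U C then works, and the diagonal entries are the eigenvalues because \<Sigma> Q = B^-1 D B and
  A = B^-1 A* B. Conversely, diagonal matrices are symmetric and commute, which gives both
  identities.\<close>

lemma matrix_inv_unique:
  fixes A B :: "real^'n^'n"
  assumes "A ** B = mat 1"
  shows "matrix_inv A = B"
proof -
  have "B ** A = mat 1" using assms by (rule matrix_left_right_inverse1)
  then have "\<exists>X. A ** X = mat 1 \<and> X ** A = mat 1" using assms by blast
  then have inv: "A ** matrix_inv A = mat 1 \<and> matrix_inv A ** A = mat 1"
    unfolding matrix_inv_def by (rule someI_ex)
  have "matrix_inv A = matrix_inv A ** (A ** B)" using assms by simp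
  also have "\<dots> = B" using inv by (simp add: matrix_mul_assoc)
  finally show ?thesis .
qed

lemma matrix_inv_right:
  fixes A :: "real^'n^'n"
  assumes "invertible A"
  shows "A ** matrix_inv A = mat 1"
proof -
  obtain B where "A ** B = mat 1" using assms invertible_right_inverse by auto
  then show ?thesis by (simp add: matrix_inv_unique)
qed

lemma matrix_inv_left:
  fixes A :: "real^'n^'n"
  assumes "invertible A"
  shows "matrix_inv A ** A = mat 1"
  using matrix_inv_right[OF assms] by (rule matrix_left_right_inverse1)

lemma matrix_mul_inv_right_cancel:
  fixes A :: "real^'n^'n" and X :: "real^'n^'m"
  assumes "invertible A"
  shows "X ** A ** matrix_inv A = X"
  by (metis assms matrix_inv_right matrix_mul_assoc matrix_mul_rid)

lemma matrix_mul_inv_left_cancel: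
  fixes A :: "real^'n^'n" and X :: "real^'n^'m"
  assumes "invertible A"
  shows "X ** matrix_inv A ** A = X"
  by (metis assms matrix_inv_left matrix_mul_assoc matrix_mul_rid)

lemmas matrix_inv_cancel =
  matrix_inv_left matrix_inv_right matrix_mul_inv_left_cancel matrix_mul_inv_right_cancel

lemma matrix_inv_transpose:
  fixes A :: "real^'n^'n"
  assumes "invertible A"
  shows "matrix_inv (transpose A) = transpose (matrix_inv A)"
  by (rule matrix_inv_unique) (simp add: matrix_transpose_mul[symmetric] matrix_inv_left assms)

lemma matrix_inv_mult:
  fixes A B :: "real^'n^'n"
  assumes "invertible A" "invertible B"
  shows "matrix_inv (A ** B) = matrix_inv B ** matrix_inv A"
  by (rule matrix_inv_unique) (simp add: assms matrix_mul_assoc matrix_inv_cancel)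

lemma orthogonal_matrix_invertible:
  fixes U :: "real^'n^'n"
  shows "orthogonal_matrix U \<Longrightarrow> invertible U"
  unfolding orthogonal_matrix_def invertible_def by (intro exI[of _ "transpose U"]) simp

lemma matrix_inv_orthogonal:
  fixes U :: "real^'n^'n"
  shows "orthogonal_matrix U \<Longrightarrow> matrix_inv U = transpose U"
  by (simp add: orthogonal_matrix_def matrix_inv_unique)

definition diag_matrix :: "('n \<Rightarrow> real) \<Rightarrow> real^'n^'n" where
  "diag_matrix f = (\<chi> i j. if i = j then f i else 0)"

lemma diag_mat_iff_diag_matrix: "diag_mat D \<longleftrightarrow> (\<exists>f. D = diag_matrix f)"
proof
  assume "diag_mat D"
  then have "D = diag_matrix (\<lambda>i. D $ i $ i)"
    by (auto simp: vec_eq_iff diag_mat_def diag_matrix_def)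
  then show "\<exists>f. D = diag_matrix f" by blast
qed (auto simp: diag_mat_def diag_matrix_def)

lemma diag_matrix_mult: "diag_matrix f ** diag_matrix g = diag_matrix (\<lambda>i. f i * g i)"
proof -
  have "(diag_matrix f ** diag_matrix g) $ i $ j
      = (\<Sum>k\<in>UNIV. if k = i then diag_matrix (\<lambda>i. f i * g i) $ i $ j else 0)" for i j
    unfolding matrix_matrix_mult_def diag_matrix_def vec_lambda_beta by (rule sum.cong) auto
  then show ?thesis by (simp add: vec_eq_iff)
qed

lemma transpose_diag_matrix: "transpose (diag_matrix f) = diag_matrix f"
proof -
  have "transpose (diag_matrix f) $ i $ j = diag_matrix f $ i $ j" for i j
    by (cases "i = j") (simp_all add: transpose_def diag_matrix_def)
  then show ?thesis by (simp add: vec_eq_iff)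
qed

lemma det_diag_matrix: "det (diag_matrix f) = (\<Prod>i\<in>UNIV. f i)"
  by (simp add: det_diagonal diag_matrix_def)

lemma diag_mat_transpose: "diag_mat D \<Longrightarrow> transpose D = D"
  by (auto simp: diag_mat_iff_diag_matrix transpose_diag_matrix)

lemma diag_mat_mult_commute: "diag_mat D \<Longrightarrow> diag_mat E \<Longrightarrow> D ** E = E ** D"
  by (auto simp: diag_mat_iff_diag_matrix diag_matrix_mult mult.commute)

lemma quadratic_nonpos_imp_linear_coeff_zero:
  fixes c K :: real
  assumes "\<And>t. 2 * t * c + t\<^sup>2 * K \<le> 0"
  shows "c = 0"
proof (rule ccontr)
  assume "c \<noteq> 0"
  define a where "a = \<bar>K\<bar> + 1"
  have "a > 0" by (simp add: a_def add_nonneg_pos)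
  have "2 * (c / a) * c + (c / a)\<^sup>2 * K = c\<^sup>2 / a\<^sup>2 * (2 * a + K)"
    using \<open>a > 0\<close> by (simp add: field_simps power2_eq_square)
  also have "\<dots> > 0"
    using \<open>c \<noteq> 0\<close> \<open>a > 0\<close> by (intro mult_pos_pos) (auto simp: a_def)
  finally show False using assms[of "c / a"] by simp
qed

lemma symmetric_matrix_inner_commute:
  fixes S :: "real^'n^'n"
  assumes "transpose S = S"
  shows "x \<bullet> (S *v y) = (S *v x) \<bullet> y"
  by (metis assms dot_lmul_matrix transpose_matrix_vector)

lemma quadratic_form_attains_max_on_subspace:
  fixes S :: "real^'n^'n"
  assumes V: "subspace V" "V \<noteq> {0}"
  obtains x where "x \<in> V" "norm x = 1"
    "\<And>y. y \<in> V \<Longrightarrow> y \<bullet> (S *v y) \<le> (x \<bullet> (S *v x)) * (y \<bullet> y)"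
proof -
  let ?K = "V \<inter> sphere 0 1" and ?f = "\<lambda>x::real^'n. x \<bullet> (S *v x)"
  obtain v where "v \<in> V" "v \<noteq> 0" using V subspace_0 by blast
  then have "v /\<^sub>R norm v \<in> ?K" using V by (auto simp: subspace_scale)
  moreover have "compact ?K"
    by (intro closed_Int_compact closed_subspace V compact_sphere)
  moreover have "continuous_on ?K ?f"
    by (intro continuous_intros linear_continuous_on matrix_vector_mul_bounded_linear)
  ultimately obtain x where x: "x \<in> ?K" and max: "\<And>y. y \<in> ?K \<Longrightarrow> ?f y \<le> ?f x"
    using continuous_attains_sup[of ?K ?f] by blast
  have "?f y \<le> ?f x * (y \<bullet> y)" if "y \<in> V" for y
  proof (cases "y = 0")
    case False
    have "?f (y /\<^sub>R norm y) \<le> ?f x" using that False V by (intro max) (auto simp: subspace_scale)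
    moreover have "?f (y /\<^sub>R norm y) = ?f y / (y \<bullet> y)"
      by (simp add: matrix_vector_mult_scaleR power2_norm_eq_inner[symmetric] power2_eq_square
          divide_simps)
    ultimately show ?thesis using False by (simp add: divide_le_eq)
  qed simp
  then show ?thesis using that x by auto
qed

text \<open>A maximiser x of the Rayleigh quotient is an eigenvector: the residual w = S x - l x lies
  in V and is orthogonal to x, and comparing the quotient at x + t w with its maximum for all t
  forces w \<bullet> S x = w \<bullet> w to vanish.\<close>
lemma symmetric_matrix_eigenvector_in_invariant_subspace:
  fixes S :: "real^'n^'n"
  assumes S: "transpose S = S" and V: "subspace V" "V \<noteq> {0}" and inv: "(*v) S ` V \<subseteq> V"
  obtains x l where "x \<in> V" "norm x = 1" "S *v x = l *\<^sub>R x"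
proof -
  obtain x where x: "x \<in> V" "norm x = 1"
    and max: "\<And>y. y \<in> V \<Longrightarrow> y \<bullet> (S *v y) \<le> (x \<bullet> (S *v x)) * (y \<bullet> y)"
    using quadratic_form_attains_max_on_subspace[OF V] by blast
  define l where "l = x \<bullet> (S *v x)"
  define w where "w = S *v x - l *\<^sub>R x"
  have xx: "x \<bullet> x = 1" using x by (simp add: norm_eq_1)
  have wV: "w \<in> V" unfolding w_def using x inv V by (auto simp: subspace_diff subspace_scale)
  have xw: "x \<bullet> w = 0" unfolding w_def l_def using xx by (simp add: inner_diff_right)
  have wSx: "w \<bullet> (S *v x) = w \<bullet> w"
    using xw by (simp add: w_def inner_diff_left inner_diff_right inner_commute)
  have "2 * t * (w \<bullet> (S *v x)) + t\<^sup>2 * (w \<bullet> (S *v w) - l * (w \<bullet> w)) \<le> 0" for t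
  proof -
    have "x + t *\<^sub>R w \<in> V" using x wV V by (simp add: subspace_add subspace_scale)
    from max[OF this] show ?thesis
      using xx xw symmetric_matrix_inner_commute[OF S, of x w]
      by (simp add: l_def inner_add_left inner_add_right matrix_vector_right_distrib
          matrix_vector_mult_scaleR inner_commute power2_eq_square algebra_simps)
  qed
  then have "w \<bullet> w = 0" using quadratic_nonpos_imp_linear_coeff_zero wSx by metis
  then have "S *v x = l *\<^sub>R x" by (simp add: w_def)
  with x that show ?thesis by blast
qed

lemma commuting_symmetric_matrices_common_eigenvector:
  fixes S T :: "real^'n^'n"
  assumes S: "transpose S = S" and T: "transpose T = T" and comm: "S ** T = T ** S"
    and V: "subspace V" "V \<noteq> {0}" and invS: "(*v) S ` V \<subseteq> V" and invT: "(*v) T ` V \<subseteq> V"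
  obtains v a b where "v \<in> V" "norm v = 1" "S *v v = a *\<^sub>R v" "T *v v = b *\<^sub>R v"
proof -
  obtain x a where x: "x \<in> V" "norm x = 1" "S *v x = a *\<^sub>R x"
    using symmetric_matrix_eigenvector_in_invariant_subspace[OF S V invS] by blast
  define E where "E = {y \<in> V. S *v y = a *\<^sub>R y}"
  have "subspace E"
    using V(1) unfolding subspace_def E_def
    by (auto simp: matrix_vector_right_distrib matrix_vector_mult_scaleR scaleR_add_right)
  moreover have "E \<noteq> {0}"
  proof
    assume "E = {0}"
    moreover have "x \<in> E" using x by (simp add: E_def)
    ultimately show False using \<open>norm x = 1\<close> by simp
  qed
  moreover have "(*v) T ` E \<subseteq> E"
  proof clarify
    fix y assume "y \<in> E"
    then have "y \<in> V" "S *v y = a *\<^sub>R y" by (simp_all add: E_def)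
    moreover have "S *v (T *v y) = T *v (S *v y)" by (simp add: matrix_vector_mul_assoc comm)
    ultimately show "T *v y \<in> E" using invT by (auto simp: E_def matrix_vector_mult_scaleR)
  qed
  ultimately obtain v b where "v \<in> E" "norm v = 1" "T *v v = b *\<^sub>R v"
    using symmetric_matrix_eigenvector_in_invariant_subspace[OF T] by metis
  then show ?thesis using that by (auto simp: E_def)
qed

lemma commuting_symmetric_matrices_common_orthonormal_eigenbasis:
  fixes S T :: "real^'n^'n"
  assumes S: "transpose S = S" and T: "transpose T = T" and comm: "S ** T = T ** S"
  shows "subspace V \<Longrightarrow> (*v) S ` V \<subseteq> V \<Longrightarrow> (*v) T ` V \<subseteq> V \<Longrightarrow>
    \<exists>B \<subseteq> V. span B = V \<and> pairwise orthogonal B \<and>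
      (\<forall>b\<in>B. norm b = 1 \<and> (\<exists>a. S *v b = a *\<^sub>R b) \<and> (\<exists>a. T *v b = a *\<^sub>R b))"
proof (induction "dim V" arbitrary: V rule: less_induct)
  case less
  show ?case
  proof (cases "V = {0}")
    case True
    then show ?thesis by (intro exI[of _ "{}"]) auto
  next
    case False
    obtain v a b where v: "v \<in> V" "norm v = 1" "S *v v = a *\<^sub>R v" "T *v v = b *\<^sub>R v"
      using commuting_symmetric_matrices_common_eigenvector[OF S T comm less.prems(1) False
          less.prems(2,3)] .
    define W where "W = V \<inter> {x. v \<bullet> x = 0}"
    have W: "subspace W"
      unfolding W_def using less.prems(1) subspace_hyperplane by (rule subspace_inter)
    have orth: "v \<bullet> (M *v x) = 0" if "transpose M = M" "M *v v = c *\<^sub>R v" "v \<bullet> x = 0" for M c x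
      using that symmetric_matrix_inner_commute[OF that(1), of v x] by simp
    have "(*v) S ` W \<subseteq> W" "(*v) T ` W \<subseteq> W"
      using less.prems(2,3) orth[OF S v(3)] orth[OF T v(4)] by (auto simp: W_def)
    moreover have "dim W < dim V"
    proof -
      have "v \<notin> W" using v(2) by (simp add: W_def norm_eq_1)
      moreover have "W \<subseteq> V" unfolding W_def by blast
      ultimately have "W \<subset> V" using v(1) by blast
      then have "span W \<subset> span V"
        by (simp only: span_eq_iff[THEN iffD2, OF W] span_eq_iff[THEN iffD2, OF less.prems(1)])
      then show ?thesis by (rule dim_psubset)
    qed
    ultimately obtain B where B: "B \<subseteq> W" "span B = W" "pairwise orthogonal B"
        "\<forall>b\<in>B. norm b = 1 \<and> (\<exists>a. S *v b = a *\<^sub>R b) \<and> (\<exists>a. T *v b = a *\<^sub>R b)"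
      using less.hyps[OF _ W] by blast
    have "span (insert v B) = V"
    proof
      show "span (insert v B) \<subseteq> V"
        using B(1) v(1) less.prems(1) by (intro span_minimal) (auto simp: W_def)
      show "V \<subseteq> span (insert v B)"
      proof
        fix x assume "x \<in> V"
        then have "x - (v \<bullet> x) *\<^sub>R v \<in> span B"
          using B(2) v less.prems(1)
          by (simp add: W_def subspace_diff subspace_scale inner_diff_right norm_eq_1)
        moreover have "span B \<subseteq> span (insert v B)" by (rule span_mono) blast
        moreover have "(v \<bullet> x) *\<^sub>R v \<in> span (insert v B)" by (simp add: span_base span_scale)
        ultimately have "x - (v \<bullet> x) *\<^sub>R v + (v \<bullet> x) *\<^sub>R v \<in> span (insert v B)"
          by (blast intro: span_add)
        then show "x \<in> span (insert v B)" by simp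
      qed
    qed
    moreover have "pairwise orthogonal (insert v B)"
      using B(1,3) by (auto simp: pairwise_insert W_def orthogonal_def inner_commute)
    ultimately show ?thesis
      using B(1,4) v by (intro exI[of _ "insert v B"]) (auto simp: W_def)
  qed
qed

lemma matrix_conjugate_entry:
  fixes U M :: "real^'n^'n"
  shows "(U ** M ** transpose U) $ i $ j = row i U \<bullet> (M *v row j U)"
proof -
  have "(U ** M ** transpose U) $ i $ j = (\<Sum>k\<in>UNIV. \<Sum>l\<in>UNIV. U$i$l * (M$l$k * U$j$k))"
    by (simp add: matrix_matrix_mult_def transpose_def sum_distrib_right mult.assoc)
  also have "\<dots> = (\<Sum>l\<in>UNIV. \<Sum>k\<in>UNIV. U$i$l * (M$l$k * U$j$k))"
    by (rule sum.swap)
  also have "\<dots> = row i U \<bullet> (M *v row j U)"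
    by (simp add: inner_vec_def matrix_vector_mult_def row_def sum_distrib_left)
  finally show ?thesis .
qed

theorem commuting_symmetric_matrices_simultaneously_diagonalizable:
  fixes S T :: "real^'n^'n"
  assumes S: "transpose S = S" and T: "transpose T = T" and comm: "S ** T = T ** S"
  obtains U :: "real^'n^'n" where "orthogonal_matrix U"
    "diag_mat (U ** S ** transpose U)" "diag_mat (U ** T ** transpose U)"
proof -
  obtain B where B: "span B = UNIV" "pairwise orthogonal B"
      "\<forall>b\<in>B. norm b = 1 \<and> (\<exists>a. S *v b = a *\<^sub>R b) \<and> (\<exists>a. T *v b = a *\<^sub>R b)"
    using commuting_symmetric_matrices_common_orthonormal_eigenbasis[OF S T comm, of UNIV] by auto
  have "independent B"
    using B(2,3) pairwise_orthogonal_independent by fastforce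
  then have "finite B" "card B = CARD('n)"
    using B(1) dim_eq_card_independent[of B] dim_span[of B] by (auto simp: finiteI_independent)
  then obtain u where u: "bij_betw u (UNIV :: 'n set) B"
    using finite_same_card_bij[of "UNIV :: 'n set" B] by auto
  define U :: "real^'n^'n" where "U = (\<chi> i. u i)"
  have row_U: "row i U = u i" for i by (simp add: U_def row_def vec_eq_iff)
  have uB: "u i \<in> B" for i using u by (auto simp: bij_betw_def)
  have orth: "orthogonal (u i) (u j)" if "i \<noteq> j" for i j
  proof -
    have "u i \<noteq> u j" using that bij_betw_imp_inj_on[OF u] by (auto dest: injD)
    then show ?thesis using B(2) uB unfolding pairwise_def by blast
  qed
  have "orthogonal_matrix U"
    unfolding orthogonal_matrix_orthonormal_rows row_U using B(3) uB orth by blast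
  moreover have "diag_mat (U ** M ** transpose U)" if M: "\<forall>b\<in>B. \<exists>a. M *v b = a *\<^sub>R b" for M
  proof -
    have "row i U \<bullet> (M *v row j U) = 0" if "i \<noteq> j" for i j
    proof -
      obtain a where "M *v u j = a *\<^sub>R u j" using M uB by blast
      then show ?thesis using orth[OF that] by (simp add: row_U orthogonal_def)
    qed
    then show ?thesis by (simp add: diag_mat_def matrix_conjugate_entry)
  qed
  ultimately show ?thesis using that B(3) by blast
qed

lemma pos_def_mat_factorization:
  fixes Q :: "real^'n^'n"
  assumes "pos_def_mat Q"
  obtains C :: "real^'n^'n" where "invertible C" "Q = transpose C ** C"
proof -
  have Q: "transpose Q = Q" and pos: "\<And>x. x \<noteq> 0 \<Longrightarrow> x \<bullet> (Q *v x) > 0"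
    using assms by (auto simp: pos_def_mat_def sym_mat_def)
  obtain U where U: "orthogonal_matrix U" "diag_mat (U ** Q ** transpose U)"
    using commuting_symmetric_matrices_simultaneously_diagonalizable[OF Q Q refl] by metis
  then obtain f where f: "U ** Q ** transpose U = diag_matrix f"
    by (auto simp: diag_mat_iff_diag_matrix)
  have f_pos: "f i > 0" for i
  proof -
    have "row i U \<noteq> 0"
      using U(1) unfolding orthogonal_matrix_orthonormal_rows by (metis norm_zero zero_neq_one)
    then have "(U ** Q ** transpose U) $ i $ i > 0" by (simp add: matrix_conjugate_entry pos)
    then show ?thesis by (simp add: f diag_matrix_def)
  qed
  define C where "C = diag_matrix (\<lambda>i. sqrt (f i)) ** U"
  have "det C \<noteq> 0"
    using f_pos det_orthogonal_matrix[OF U(1)]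
    by (auto simp: C_def det_mul det_diag_matrix less_imp_neq[symmetric])
  moreover have "transpose C ** C = Q"
  proof -
    have "transpose C ** C
        = transpose U ** (diag_matrix (\<lambda>i. sqrt (f i)) ** diag_matrix (\<lambda>i. sqrt (f i))) ** U"
      by (simp add: C_def matrix_transpose_mul transpose_diag_matrix matrix_mul_assoc)
    also have "\<dots> = transpose U ** (U ** Q ** transpose U) ** U"
      using f_pos by (simp add: f diag_matrix_mult abs_of_pos)
    also have "\<dots> = Q"
      using orthogonal_matrix_invertible[OF U(1)]
      by (simp add: matrix_inv_orthogonal[OF U(1), symmetric] matrix_inv_cancel matrix_mul_assoc)
    finally show ?thesis .
  qed
  ultimately show ?thesis using that[of C] by (simp add: invertible_det_nz)
qed

lemma matrix_diff_ldistrib: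
  fixes A :: "real^'n^'m" and B C :: "real^'p^'n"
  shows "A ** (B - C) = A ** B - A ** C"
  by (vector matrix_matrix_mult_def sum_subtractf[symmetric] algebra_simps)

lemma matrix_diff_rdistrib:
  fixes A B :: "real^'n^'m" and C :: "real^'p^'n"
  shows "(A - B) ** C = A ** C - B ** C"
  by (vector matrix_matrix_mult_def sum_subtractf[symmetric] algebra_simps)

lemma det_char_matrix_similar:
  fixes P M :: "real^'n^'n"
  assumes "invertible P"
  shows "det (x *\<^sub>R mat 1 - matrix_inv P ** M ** P) = det (x *\<^sub>R mat 1 - M)"
proof -
  have "x *\<^sub>R mat 1 - matrix_inv P ** M ** P = matrix_inv P ** (x *\<^sub>R mat 1 - M) ** P"
    using assms
    by (simp add: matrix_diff_ldistrib matrix_diff_rdistrib matrix_scalar_ac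
        scalar_matrix_assoc[symmetric] matrix_inv_left)
  then have "det (x *\<^sub>R mat 1 - matrix_inv P ** M ** P)
      = det (matrix_inv P ** P) * det (x *\<^sub>R mat 1 - M)"
    by (simp add: det_mul)
  then show ?thesis using assms by (simp add: matrix_inv_left)
qed

lemma diag_of_eigenvalues_similar:
  fixes P D :: "real^'n^'n"
  assumes "diag_mat D" "invertible P"
  shows "diag_of_eigenvalues D (matrix_inv P ** D ** P)"
  unfolding diag_of_eigenvalues_def
proof (intro conjI allI)
  fix x :: real
  have "det (x *\<^sub>R mat 1 - D) = (\<Prod>i\<in>UNIV. x - D $ i $ i)"
    using assms(1) by (subst det_diagonal) (auto simp: diag_mat_def mat_def)
  then show "det (x *\<^sub>R mat 1 - matrix_inv P ** D ** P) = (\<Prod>i\<in>UNIV. x - D $ i $ i)"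
    using det_char_matrix_similar[OF assms(2)] by simp
qed (rule assms(1))

lemma matrix_congruence_inverse:
  fixes B X :: "real^'n^'n"
  assumes "invertible B"
  shows "matrix_inv B ** (B ** X ** transpose B) ** matrix_inv (transpose B) = X"
  using assms transpose_invertible[OF assms] by (simp add: matrix_mul_assoc matrix_inv_cancel)

lemma matrix_similarity_inverse:
  fixes B X :: "real^'n^'n"
  assumes "invertible B"
  shows "matrix_inv B ** (B ** X ** matrix_inv B) ** B = X"
  using assms by (simp add: matrix_mul_assoc matrix_inv_cancel)

lemma diagonal_reduction_imp_commutation:
  fixes B D Astar Sigma Q A :: "real^'n^'n"
  assumes B: "invertible B" and D: "diag_mat D" and Astar: "diag_mat Astar"
    and Q: "Q = transpose B ** B"
    and Sigma: "Sigma = matrix_inv B ** D ** matrix_inv (transpose B)"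
    and A: "A = matrix_inv B ** Astar ** B"
  shows "A ** Sigma = Sigma ** transpose A" "Q ** A = transpose A ** Q"
proof -
  note simps = matrix_transpose_mul matrix_inv_transpose[OF B, symmetric] matrix_mul_assoc
    matrix_inv_cancel B transpose_invertible[OF B] diag_mat_transpose[OF Astar]
  have "A ** Sigma = matrix_inv B ** (Astar ** D) ** matrix_inv (transpose B)"
    by (simp add: A Sigma simps)
  also have "\<dots> = matrix_inv B ** (D ** Astar) ** matrix_inv (transpose B)"
    by (simp only: diag_mat_mult_commute[OF Astar D])
  also have "\<dots> = Sigma ** transpose A"
    by (simp add: A Sigma simps diag_mat_transpose[OF D])
  finally show "A ** Sigma = Sigma ** transpose A" .
  show "Q ** A = transpose A ** Q"
    by (simp add: A Q simps)
qed

lemma commutation_imp_diagonal_reduction: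
  fixes Sigma Q A :: "real^'n^'n"
  assumes Sigma: "transpose Sigma = Sigma" and Q: "pos_def_mat Q"
    and AS: "A ** Sigma = Sigma ** transpose A" and QA: "Q ** A = transpose A ** Q"
  obtains B D Astar :: "real^'n^'n" where "invertible B" "Q = transpose B ** B"
    "Sigma = matrix_inv B ** D ** matrix_inv (transpose B)" "A = matrix_inv B ** Astar ** B"
    "diag_mat D" "diag_mat Astar"
proof -
  obtain C :: "real^'n^'n" where C: "invertible C" and QC: "Q = transpose C ** C"
    using pos_def_mat_factorization[OF Q] by blast
  note simps = matrix_transpose_mul matrix_inv_transpose[OF C, symmetric] matrix_mul_assoc
    matrix_inv_cancel C transpose_invertible[OF C]
  define S' where "S' = C ** Sigma ** transpose C"
  define A' where "A' = C ** A ** matrix_inv C"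
  have S': "transpose S' = S'" by (simp add: S'_def Sigma simps)
  have A': "transpose A' = A'"
  proof -
    have "transpose A' = matrix_inv (transpose C) ** (transpose A ** Q) ** matrix_inv C"
      by (simp add: A'_def QC simps)
    also have "\<dots> = matrix_inv (transpose C) ** (Q ** A) ** matrix_inv C" by (simp only: QA)
    also have "\<dots> = A'" by (simp add: A'_def QC simps)
    finally show ?thesis .
  qed
  have A'S': "A' ** S' = C ** (A ** Sigma) ** transpose C"
    by (simp add: A'_def S'_def simps)
  then have "transpose (A' ** S') = A' ** S'"
    by (simp add: matrix_transpose_mul Sigma matrix_mul_assoc AS)
  then have comm: "S' ** A' = A' ** S'"
    by (simp add: matrix_transpose_mul S' A')
  obtain U :: "real^'n^'n" where U: "orthogonal_matrix U"
    and "diag_mat (U ** S' ** transpose U)" "diag_mat (U ** A' ** transpose U)"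
    using commuting_symmetric_matrices_simultaneously_diagonalizable[OF S' A' comm] by blast
  define B where "B = U ** C"
  have U_inv: "invertible U" using U by (rule orthogonal_matrix_invertible)
  have B_inv: "invertible B" unfolding B_def using U_inv C by (rule invertible_mult)
  show ?thesis
  proof (rule that[OF B_inv])
    show "Q = transpose B ** B"
      using U_inv by (simp add: B_def QC matrix_transpose_mul matrix_mul_assoc
          matrix_inv_orthogonal[OF U, symmetric] matrix_inv_cancel)
    have "B ** Sigma ** transpose B = U ** S' ** transpose U"
      by (simp add: B_def S'_def matrix_transpose_mul matrix_mul_assoc)
    then show "diag_mat (B ** Sigma ** transpose B)" using \<open>diag_mat (U ** S' ** _)\<close> by simp
    have "B ** A ** matrix_inv B = U ** A' ** transpose U"
      by (simp add: B_def A'_def matrix_inv_mult[OF U_inv C] matrix_inv_orthogonal[OF U]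
          matrix_mul_assoc)
    then show "diag_mat (B ** A ** matrix_inv B)" using \<open>diag_mat (U ** A' ** _)\<close> by simp
  qed (simp_all only: matrix_congruence_inverse[OF B_inv] matrix_similarity_inverse[OF B_inv])
qed

theorem mainTheorem10:
  fixes Sigma Q A :: "real^'p^'p"
  assumes "pos_def_mat Sigma" and "pos_def_mat Q"
  shows "(A ** Sigma = Sigma ** transpose A \<and> Q ** A = transpose A ** Q) \<longleftrightarrow>
    (\<exists>B D Astar :: real^'p^'p. invertible B \<and>
       Q = transpose B ** B \<and>
       Sigma = matrix_inv B ** D ** matrix_inv (transpose B) \<and>
       A = matrix_inv B ** Astar ** B \<and>
       diag_of_eigenvalues D (Sigma ** Q) \<and>
       diag_of_eigenvalues Astar A)"
proof
  assume "A ** Sigma = Sigma ** transpose A \<and> Q ** A = transpose A ** Q"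
  moreover have "transpose Sigma = Sigma"
    using assms(1) by (simp add: pos_def_mat_def sym_mat_def)
  ultimately obtain B D Astar :: "real^'p^'p" where B: "invertible B"
    and Q: "Q = transpose B ** B" and Sigma: "Sigma = matrix_inv B ** D ** matrix_inv (transpose B)"
    and A: "A = matrix_inv B ** Astar ** B" and D: "diag_mat D" and Astar: "diag_mat Astar"
    using commutation_imp_diagonal_reduction[OF _ assms(2)] by blast
  have "Sigma ** Q = matrix_inv B ** D ** B"
    using B transpose_invertible[OF B] by (simp add: Sigma Q matrix_mul_assoc matrix_inv_cancel)
  then have "diag_of_eigenvalues D (Sigma ** Q)"
    using diag_of_eigenvalues_similar[OF D B] by simp
  moreover have "diag_of_eigenvalues Astar A"
    unfolding A using Astar B by (rule diag_of_eigenvalues_similar)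
  ultimately show "\<exists>B D Astar :: real^'p^'p. invertible B \<and> Q = transpose B ** B \<and>
      Sigma = matrix_inv B ** D ** matrix_inv (transpose B) \<and> A = matrix_inv B ** Astar ** B \<and>
      diag_of_eigenvalues D (Sigma ** Q) \<and> diag_of_eigenvalues Astar A"
    using B Q Sigma A by blast
next
  assume "\<exists>B D Astar :: real^'p^'p. invertible B \<and> Q = transpose B ** B \<and>
      Sigma = matrix_inv B ** D ** matrix_inv (transpose B) \<and> A = matrix_inv B ** Astar ** B \<and>
      diag_of_eigenvalues D (Sigma ** Q) \<and> diag_of_eigenvalues Astar A"
  then obtain B D Astar :: "real^'p^'p" where "invertible B" "Q = transpose B ** B"
    "Sigma = matrix_inv B ** D ** matrix_inv (transpose B)" "A = matrix_inv B ** Astar ** B"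
    "diag_mat D" "diag_mat Astar"
    by (auto simp: diag_of_eigenvalues_def)
  then show "A ** Sigma = Sigma ** transpose A \<and> Q ** A = transpose A ** Q"
    using diagonal_reduction_imp_commutation by blast
qed

end
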